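(* Let $d\ge 2$, let $n=\binom{d}{2}$, and let $A\in\mathbb{Z}^{d\times n}$ be the vertex–arc incidence matrix of the acyclic tournament graph $G_d$. As $\mathbf{c}$ ranges over all generic cost vectors in $\mathbb{R}^n$, the minimum of the arithmetic degree of the initial ideal $in_{\mathbf{c}}(I_A)$ equals $1$.
   Context: $G_d$ is the directed graph on vertices $1,\dots,d$ with the $n=\binom d2$ arcs $(i,j)$, $1\le i<j\le d$, each directed from $i$ to $j$. Its vertex–arc incidence matrix $A$ has rows indexed by vertices and columns by arcs, the column of arc $(i,j)$ having entry $1$ in row $i$, $-1$ in row $j$ and $0$ elsewhere. Work in $k[\mathbf{x}]=k[x_{i,j}:1\le i<j\le d]$ over a field $k$, writing $\mathbf{x}^{\mathbf{u}}=\prod x_{i,j}^{u_{i,j}}$. The toric ideal is $I_A=\langle \mathbf{x}^{\mathbf{u}}-\mathbf{x}^{\mathbf{v}} : A\mathbf{u}=A\mathbf{v},\ \mathbf{u},\mathbf{v}\in\mathbb{N}^n\rangle$. A cost vector $\mathbf{c}\in\mathbb{R}^n$ is generic if for every $\mathbf{b}\in\{A\mathbf{u}:\mathbf{u}\in\mathbb{N}^n\}$ the program $\min\{\mathbf{c}\cdot\mathbf{x}: A\mathbf{x}=\mathbf{b},\ \mathbf{x}\in\mathbb{N}^n\}$ has a unique optimal solution; then $in_{\mathbf{c}}(I_A)$, the ideal generated by the $\mathbf{c}$-largest terms of elements of $I_A$, is a monomial ideal. For a monomial ideal $J\subseteq k[x_1,\dots,x_n]$, a standard pair is a pair $(\mathbf{x}^{\mathbf{a}},\sigma)$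 with $\sigma\subseteq[n]$ such that (i) $\mathrm{supp}(\mathbf{a})\cap\sigma=\emptyset$; (ii) no monomial $\mathbf{x}^{\mathbf{a}}\mathbf{x}^{\mathbf{w}}$ with $\mathrm{supp}(\mathbf{w})\subseteq\sigma$ lies in $J$; (iii) there is no other pair $(\mathbf{x}^{\mathbf{a}'},\sigma')$ satisfying (i),(ii) with $\mathbf{x}^{\mathbf{a}'}$ dividing $\mathbf{x}^{\mathbf{a}}$ and $\mathrm{supp}(\mathbf{x}^{\mathbf{a}}/\mathbf{x}^{\mathbf{a}'})\cup\sigma\subseteq\sigma'$. The arithmetic degree of $J$ is the number of its standard pairs. *)

theory Defs
  imports "HOL-Library.Poly_Mapping" "HOL-Library.Extended_Nat" "HOL-Algebra.Ideal"
begin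

type_synonym ('v, 'k) mpoly = "('v \<Rightarrow>\<^sub>0 nat) \<Rightarrow>\<^sub>0 'k"

text \<open>The monomial \<open>x\<^sup>u\<close> is \<open>Poly_Mapping.single u 1\<close>; \<open>exponents V\<close> plays the role of
  \<open>\<nat>\<^sup>n\<close>, with coordinates indexed by the variables in \<open>V\<close>.\<close>

abbreviation monomial :: "('v \<Rightarrow>\<^sub>0 nat) \<Rightarrow> ('v, 'k::comm_ring_1) mpoly"
  where "monomial u \<equiv> Poly_Mapping.single u 1"

definition exponents :: "'v set \<Rightarrow> ('v \<Rightarrow>\<^sub>0 nat) set"
  where "exponents V = {u. Poly_Mapping.keys u \<subseteq> V}"

definition poly_ring :: "'v set \<Rightarrow> ('v, 'k::comm_ring_1) mpoly ring"
  where "poly_ring V =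
    \<lparr>carrier = {p. Poly_Mapping.keys p \<subseteq> exponents V}, mult = (*), one = 1, zero = 0, add = (+)\<rparr>"

lemma poly_ring_cring: "cring (poly_ring V :: ('v, 'k::comm_ring_1) mpoly ring)"
proof -
  let ?C = "{p :: ('v, 'k) mpoly. Poly_Mapping.keys p \<subseteq> exponents V}"
  have add_exp: "u + v \<in> exponents V" if "u \<in> exponents V" "v \<in> exponents V" for u v
    using that keys_add[of u v] unfolding exponents_def by blast
  have add: "p + q \<in> ?C" if "p \<in> ?C" "q \<in> ?C" for p q
    using that keys_add[of p q] by blast
  have mult: "p * q \<in> ?C" if "p \<in> ?C" "q \<in> ?C" for p q
    using that keys_mult[of p q] add_exp by blast
  have one: "1 \<in> ?C"
    by (simp add: exponents_def)
  have inv: "\<exists>q\<in>?C. q + p = 0" if "p \<in> ?C" for p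
    using that by (intro bexI[of _ "- p"]) auto
  show ?thesis
    unfolding poly_ring_def
    by (intro cringI abelian_groupI comm_monoidI)
      (use add mult one inv in \<open>auto simp: algebra_simps\<close>)
qed

definition matrix_apply :: "'r set \<Rightarrow> 'v set \<Rightarrow> ('r \<Rightarrow> 'v \<Rightarrow> int) \<Rightarrow> ('v \<Rightarrow>\<^sub>0 nat) \<Rightarrow> 'r \<Rightarrow> int"
  where "matrix_apply R V A u = (\<lambda>r\<in>R. \<Sum>e\<in>V. A r e * int (Poly_Mapping.lookup u e))"

text \<open>Only the values of \<open>c\<close> on \<open>V\<close> matter, here and in everything built from \<open>cost\<close>, so a
  function \<open>c\<close> stands for its restriction, a vector in \<open>\<real>\<^sup>n\<close>.\<close>

definition cost :: "'v set \<Rightarrow> ('v \<Rightarrow> real) \<Rightarrow> ('v \<Rightarrow>\<^sub>0 nat) \<Rightarrow> real"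
  where "cost V c u = (\<Sum>e\<in>V. c e * real (Poly_Mapping.lookup u e))"

definition toric_ideal :: "'r set \<Rightarrow> 'v set \<Rightarrow> ('r \<Rightarrow> 'v \<Rightarrow> int) \<Rightarrow> ('v, 'k::comm_ring_1) mpoly set"
  where "toric_ideal R V A = genideal (poly_ring V)
    {monomial u - monomial v | u v.
      u \<in> exponents V \<and> v \<in> exponents V \<and> matrix_apply R V A u = matrix_apply R V A v}"

definition optimal :: "'r set \<Rightarrow> 'v set \<Rightarrow> ('r \<Rightarrow> 'v \<Rightarrow> int) \<Rightarrow> ('v \<Rightarrow> real) \<Rightarrow> ('r \<Rightarrow> int)
    \<Rightarrow> ('v \<Rightarrow>\<^sub>0 nat) \<Rightarrow> bool"
  where "optimal R V A c b u \<longleftrightarrow>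
    u \<in> exponents V \<and> matrix_apply R V A u = b \<and>
    (\<forall>v\<in>exponents V. matrix_apply R V A v = b \<longrightarrow> cost V c u \<le> cost V c v)"

definition generic_cost :: "'r set \<Rightarrow> 'v set \<Rightarrow> ('r \<Rightarrow> 'v \<Rightarrow> int) \<Rightarrow> ('v \<Rightarrow> real) \<Rightarrow> bool"
  where "generic_cost R V A c \<longleftrightarrow>
    (\<forall>b \<in> matrix_apply R V A ` exponents V. \<exists>!u. optimal R V A c b u)"

text \<open>The initial form collects all terms of maximal cost. There can be several of them, even for
  generic \<open>c\<close>, when they lie in different fibres of \<open>A\<close>.\<close>

definition initial_form :: "'v set \<Rightarrow> ('v \<Rightarrow> real) \<Rightarrow> ('v, 'k::comm_ring_1) mpoly \<Rightarrow> ('v, 'k) mpoly"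
  where "initial_form V c f =
    (\<Sum>u\<in>{u \<in> Poly_Mapping.keys f. \<forall>v\<in>Poly_Mapping.keys f. cost V c v \<le> cost V c u}.
       Poly_Mapping.single u (Poly_Mapping.lookup f u))"

definition initial_ideal :: "'v set \<Rightarrow> ('v \<Rightarrow> real) \<Rightarrow> ('v, 'k::comm_ring_1) mpoly set
    \<Rightarrow> ('v, 'k) mpoly set"
  where "initial_ideal V c I = genideal (poly_ring V) (initial_form V c ` I)"

text \<open>A pair \<open>(x\<^sup>a, \<sigma>)\<close> is represented by \<open>(a, \<sigma>)\<close>. Admissible pairs satisfy the first two
  conditions on standard pairs. In the third, \<open>w\<close> is the exponent of the quotient
  \<open>x\<^sup>a / x\<^sup>a'\<close>, whose existence is the divisibility requirement.\<close>

definition admissible_pair :: "'v set \<Rightarrow> ('v, 'k::comm_ring_1) mpoly set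
    \<Rightarrow> ('v \<Rightarrow>\<^sub>0 nat) \<times> 'v set \<Rightarrow> bool"
  where "admissible_pair V J = (\<lambda>(a, \<sigma>).
    a \<in> exponents V \<and> \<sigma> \<subseteq> V \<and> Poly_Mapping.keys a \<inter> \<sigma> = {} \<and>
    (\<forall>w. Poly_Mapping.keys w \<subseteq> \<sigma> \<longrightarrow> monomial a * monomial w \<notin> J))"

definition standard_pairs :: "'v set \<Rightarrow> ('v, 'k::comm_ring_1) mpoly set
    \<Rightarrow> (('v \<Rightarrow>\<^sub>0 nat) \<times> 'v set) set"
  where "standard_pairs V J = {(a, \<sigma>). admissible_pair V J (a, \<sigma>) \<and>
    \<not> (\<exists>a' \<sigma>' w. (a', \<sigma>') \<noteq> (a, \<sigma>) \<and> admissible_pair V J (a', \<sigma>') \<and>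
         a = a' + w \<and> Poly_Mapping.keys w \<union> \<sigma> \<subseteq> \<sigma>')}"

text \<open>The value lives in \<open>enat\<close> because \<open>card\<close> sends infinite sets to \<open>0\<close>.\<close>

definition arithmetic_degree :: "'v set \<Rightarrow> ('v, 'k::comm_ring_1) mpoly set \<Rightarrow> enat"
  where "arithmetic_degree V J =
    (if finite (standard_pairs V J) then enat (card (standard_pairs V J)) else \<infinity>)"

definition arcs :: "nat \<Rightarrow> (nat \<times> nat) set"
  where "arcs d = {(i, j). 1 \<le> i \<and> i < j \<and> j \<le> d}"

lemma card_arcs: "card (arcs d) = d choose 2"
proof (induction d)
  case 0
  have "arcs 0 = {}" by (auto simp: arcs_def)
  then show ?case by simp
next
  case (Suc d)
  have fin: "finite (arcs d)"
    by (rule finite_subset[of _ "{1..d} \<times> {1..d}"]) (auto simp: arcs_def)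
  have "arcs (Suc d) = arcs d \<union> (\<lambda>i. (i, Suc d)) ` {1..d}"
    by (auto simp: arcs_def)
  moreover have "card ((\<lambda>i. (i, Suc d)) ` {1..d}) = d"
    by (subst card_image) (auto simp: inj_on_def)
  moreover have "arcs d \<inter> (\<lambda>i. (i, Suc d)) ` {1..d} = {}"
    by (auto simp: arcs_def)
  ultimately have "card (arcs (Suc d)) = card (arcs d) + d"
    using fin by (simp add: card_Un_disjoint)
  then show ?case
    using Suc.IH by (simp add: numeral_2_eq_2)
qed

definition incidence :: "nat \<Rightarrow> nat \<times> nat \<Rightarrow> int"
  where "incidence v = (\<lambda>(i, j). if v = i then 1 else if v = j then - 1 else 0)"

end

theory Submission
  imports Defs
begin

text \<open>For a generic cost the monomials of the initial ideal are exactly the non-optimal ones, since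
  the coefficients of an element of the toric ideal sum to zero over each fibre of \<open>A\<close>. The monomial
  \<open>1\<close> is always optimal, so the initial ideal is proper and has a standard pair \<open>(1, \<sigma>)\<close> with \<open>\<sigma>\<close>
  of maximal size. If arcs \<open>(i, i + 1)\<close> cost \<open>0\<close> and all others cost \<open>1\<close>, then the optimal monomials
  are those supported on the Hamiltonian path \<open>1, 2, \<dots>, d\<close>: every arc can be replaced by a subpath,
  and the columns of the path are linearly independent. The initial ideal is then generated by the
  variables of the arcs off the path, and its only standard pair is \<open>(1, path)\<close>.\<close>

section \<open>Fibres and toric ideals\<close>

lemma exponents_0 [simp]: "0 \<in> exponents V"
  by (simp add: exponents_def)

lemma exponents_add: "u + v \<in> exponents V \<longleftrightarrow> u \<in> exponents V \<and> v \<in> exponents V"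
  for u v :: "'v \<Rightarrow>\<^sub>0 nat"
proof -
  have "Poly_Mapping.keys (u + v) = Poly_Mapping.keys u \<union> Poly_Mapping.keys v"
    by (auto simp: in_keys_iff lookup_add)
  then show ?thesis by (simp add: exponents_def)
qed

lemma matrix_apply_add:
  "matrix_apply R V A (u + v) = (\<lambda>r\<in>R. matrix_apply R V A u r + matrix_apply R V A v r)"
  by (auto simp: matrix_apply_def restrict_def lookup_add algebra_simps sum.distrib)

lemma matrix_apply_add_cong:
  assumes "matrix_apply R V A u = matrix_apply R V A u'" "matrix_apply R V A v = matrix_apply R V A v'"
  shows "matrix_apply R V A (u + v) = matrix_apply R V A (u' + v')"
  using assms by (simp add: matrix_apply_add)

lemma cost_add: "cost V c (u + v) = cost V c u + cost V c v"
  by (simp add: cost_def lookup_add algebra_simps sum.distrib)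

lemma cost_0 [simp]: "cost V c 0 = 0"
  by (simp add: cost_def)

lemma poly_ring_ring: "ring (poly_ring V :: ('v, 'k::comm_ring_1) mpoly ring)"
  using poly_ring_cring by (rule cring.axioms)

text \<open>Negation comes for free: it is multiplication by the constant polynomial
  \<open>- 1\<close>.\<close>

lemma poly_ring_idealI:
  fixes J :: "('v, 'k::comm_ring_1) mpoly set"
  assumes "J \<subseteq> carrier (poly_ring V)" "0 \<in> J"
    and "\<And>p q. p \<in> J \<Longrightarrow> q \<in> J \<Longrightarrow> p + q \<in> J"
    and mult: "\<And>p q. p \<in> J \<Longrightarrow> q \<in> carrier (poly_ring V) \<Longrightarrow> q * p \<in> J"
  shows "ideal J (poly_ring V)"
proof -
  interpret cring "poly_ring V :: ('v, 'k) mpoly ring" by (rule poly_ring_cring)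
  have minus: "\<ominus>\<^bsub>poly_ring V\<^esub> p \<in> J" if "p \<in> J" for p
  proof -
    have p: "p \<in> carrier (poly_ring V)" using that assms(1) by blast
    have "- 1 \<in> carrier (poly_ring V :: ('v, 'k) mpoly ring)"
      by (auto simp: poly_ring_def exponents_def)
    from mult[OF that this] have "- p \<in> J" by simp
    moreover have "- p \<in> carrier (poly_ring V)" using calculation assms(1) by blast
    then have "\<ominus>\<^bsub>poly_ring V\<^esub> p = - p"
      using p by (intro minus_equality) (auto simp: poly_ring_def)
    ultimately show ?thesis by simp
  qed
  show ?thesis
  proof (rule idealI)
    show "ring (poly_ring V :: ('v, 'k) mpoly ring)" by (rule poly_ring_ring)
    show "subgroup J (add_monoid (poly_ring V))"
    proof (rule add.subgroupI)
      show "\<ominus>\<^bsub>poly_ring V\<^esub> p \<in> J" if "p \<in> J" for p using minus[OF that] .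
    qed (use assms in \<open>auto simp: poly_ring_def\<close>)
  qed (use assms in \<open>auto simp: poly_ring_def mult.commute\<close>)
qed

section \<open>Linear functionals on polynomials\<close>

text \<open>The linear functional that extends \<open>h\<close> from exponents to polynomials. For
  the indicator of a fibre it is the sum of the coefficients over that fibre.\<close>

definition pairing :: "('u \<Rightarrow> 'k) \<Rightarrow> ('u \<Rightarrow>\<^sub>0 'k::comm_ring_1) \<Rightarrow> 'k"
  where "pairing h f = (\<Sum>u\<in>Poly_Mapping.keys f. Poly_Mapping.lookup f u * h u)"

lemma pairing_superset:
  assumes "finite S" "Poly_Mapping.keys f \<subseteq> S"
  shows "pairing h f = (\<Sum>u\<in>S. Poly_Mapping.lookup f u * h u)"
  unfolding pairing_def
  by (rule sum.mono_neutral_left) (use assms in \<open>auto simp: in_keys_iff\<close>)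

lemma pairing_add: "pairing h (f + g) = pairing h f + pairing h g"
proof -
  let ?S = "Poly_Mapping.keys f \<union> Poly_Mapping.keys g"
  have "pairing h p = (\<Sum>u\<in>?S. Poly_Mapping.lookup p u * h u)" if "p \<in> {f, g, f + g}" for p
    using that keys_add[of f g] by (intro pairing_superset) auto
  then show ?thesis
    by (simp add: lookup_add algebra_simps sum.distrib)
qed

lemma pairing_0 [simp]: "pairing h 0 = 0"
  by (simp add: pairing_def)

lemma pairing_sum: "pairing h (sum f S) = (\<Sum>i\<in>S. pairing h (f i))"
  by (induction S rule: infinite_finite_induct) (auto simp: pairing_add)

lemma pairing_single: "pairing h (Poly_Mapping.single u c) = c * h u"
  by (simp add: pairing_def)

lemma pairing_diff: "pairing h (f - g) = pairing h f - pairing h g"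
  using pairing_add[of h "f - g" g] by simp

lemma poly_mapping_expand:
  "f = (\<Sum>u\<in>Poly_Mapping.keys f. Poly_Mapping.single u (Poly_Mapping.lookup f u))"
  by (rule poly_mapping_eqI)
    (simp add: lookup_sum lookup_single when_def in_keys_iff sum.delta' cong: if_cong)

text \<open>Multiplying by \<open>p\<close> moves the test function: \<open>f\<close> is tested
  against the translates of \<open>h\<close> by the exponents of \<open>p\<close>. This is what
  makes annihilators of translation-stable families into ideals.\<close>

lemma pairing_mult:
  fixes p f :: "('v, 'k::comm_ring_1) mpoly"
  shows "pairing h (p * f)
    = (\<Sum>v\<in>Poly_Mapping.keys p. Poly_Mapping.lookup p v * pairing (\<lambda>u. h (v + u)) f)"
proof -
  have "p * f = (\<Sum>v\<in>Poly_Mapping.keys p. \<Sum>u\<in>Poly_Mapping.keys f.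
      Poly_Mapping.single (v + u) (Poly_Mapping.lookup p v * Poly_Mapping.lookup f u))"
    by (subst (1) poly_mapping_expand[of p], subst (1) poly_mapping_expand[of f])
      (simp add: sum_product mult_single)
  then have "pairing h (p * f) = (\<Sum>v\<in>Poly_Mapping.keys p. \<Sum>u\<in>Poly_Mapping.keys f.
      Poly_Mapping.lookup p v * Poly_Mapping.lookup f u * h (v + u))"
    by (simp only: pairing_sum pairing_single)
  then show ?thesis
    by (simp add: pairing_def[where f = f] sum_distrib_left mult.assoc)
qed

lemma poly_ring_mult_closed:
  fixes p f :: "('v, 'k::comm_ring_1) mpoly"
  assumes "p \<in> carrier (poly_ring V)" "f \<in> carrier (poly_ring V)"
  shows "p * f \<in> carrier (poly_ring V)"
  using assms keys_mult[of p f] by (fastforce simp: poly_ring_def exponents_add)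

text \<open>Functions constant on fibres kill the generating binomials. Their common kernel is an
  ideal because a translate of such a function is again constant on fibres, so it contains the whole
  toric ideal.\<close>

lemma toric_ideal_pairing:
  fixes f :: "('v, 'k::comm_ring_1) mpoly"
  assumes "f \<in> toric_ideal R V A"
  shows "f \<in> carrier (poly_ring V)"
    and "(\<And>u v. u \<in> exponents V \<Longrightarrow> v \<in> exponents V \<Longrightarrow>
           matrix_apply R V A u = matrix_apply R V A v \<Longrightarrow> h u = h v) \<Longrightarrow> pairing h f = 0"
proof -
  define fibre_inv where "fibre_inv h \<longleftrightarrow> (\<forall>u\<in>exponents V. \<forall>v\<in>exponents V.
    matrix_apply R V A u = matrix_apply R V A v \<longrightarrow> h u = h v)" for h :: "_ \<Rightarrow> 'k"
  \<comment> \<open>All \<open>h\<close> have to be quantified inside \<open>K\<close>: closure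
    under multiplication replaces a given \<open>h\<close> by its translates.\<close>
  define K where "K = {f \<in> carrier (poly_ring V). \<forall>h. fibre_inv h \<longrightarrow> pairing h f = 0}"
  have "ideal K (poly_ring V)"
  proof (rule poly_ring_idealI)
    fix p q :: "('v, 'k) mpoly" assume p: "p \<in> K" and q: "q \<in> carrier (poly_ring V)"
    have "pairing h (q * p) = 0" if h: "fibre_inv h" for h
    proof -
      have "pairing (\<lambda>u. h (v + u)) p = 0" if "v \<in> Poly_Mapping.keys q" for v
      proof -
        have "v \<in> exponents V" using that q by (auto simp: poly_ring_def)
        have "fibre_inv (\<lambda>u. h (v + u))"
          unfolding fibre_inv_def
        proof (intro ballI impI)
          fix u u' assume "u \<in> exponents V" "u' \<in> exponents V"
            and eq: "matrix_apply R V A u = matrix_apply R V A u'"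
          with \<open>v \<in> exponents V\<close> have "v + u \<in> exponents V" "v + u' \<in> exponents V"
            by (simp_all add: exponents_add)
          then show "h (v + u) = h (v + u')"
            using h matrix_apply_add_cong[OF refl eq] unfolding fibre_inv_def by blast
        qed
        then show ?thesis using p by (simp add: K_def)
      qed
      then show ?thesis by (simp add: pairing_mult)
    qed
    then show "q * p \<in> K" using p q by (simp add: K_def poly_ring_mult_closed)
  next
    fix p q :: "('v, 'k) mpoly" assume "p \<in> K" "q \<in> K"
    then show "p + q \<in> K"
      using keys_add[of p q] by (auto simp: K_def pairing_add poly_ring_def)
  qed (auto simp: K_def poly_ring_def)
  then have "toric_ideal R V A \<subseteq> K"
    unfolding toric_ideal_def
  proof (rule ring.genideal_minimal[OF poly_ring_ring], safe)
    fix u v assume uv: "u \<in> exponents V" "v \<in> exponents V"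
      "matrix_apply R V A u = matrix_apply R V A v"
    have "Poly_Mapping.keys (monomial u - monomial v :: ('v, 'k) mpoly) \<subseteq> {u, v}"
      using keys_diff[of "monomial u :: ('v, 'k) mpoly" "monomial v"] by auto
    moreover have "h u = h v" if "fibre_inv h" for h
      using that uv unfolding fibre_inv_def by blast
    ultimately show "monomial u - monomial v \<in> K"
      using uv(1,2) by (auto simp: K_def pairing_diff pairing_single poly_ring_def)
  qed
  then have "f \<in> K" using assms by blast
  then show "f \<in> carrier (poly_ring V)"
    and "(\<And>u v. u \<in> exponents V \<Longrightarrow> v \<in> exponents V \<Longrightarrow>
           matrix_apply R V A u = matrix_apply R V A v \<Longrightarrow> h u = h v) \<Longrightarrow> pairing h f = 0"
    unfolding K_def fibre_inv_def by blast+
qed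

text \<open>The coefficients over the fibre of \<open>u\<close> sum to zero, so the nonzero
  coefficient at \<open>u\<close> cannot be the only one there.\<close>

lemma toric_ideal_other_key:
  fixes f :: "('v, 'k::comm_ring_1) mpoly"
  assumes "f \<in> toric_ideal R V A" "u \<in> Poly_Mapping.keys f"
  obtains v where "v \<in> Poly_Mapping.keys f" "v \<noteq> u" "v \<in> exponents V"
    "matrix_apply R V A v = matrix_apply R V A u"
proof (rule ccontr)
  assume neg: "\<not> thesis"
  let ?h = "\<lambda>v. if matrix_apply R V A v = matrix_apply R V A u then 1 else 0 :: 'k"
  have exps: "Poly_Mapping.keys f \<subseteq> exponents V"
    using toric_ideal_pairing(1)[OF assms(1)] by (simp add: poly_ring_def)
  \<comment> \<open>Under the negated claim \<open>u\<close> is the only key of \<open>f\<close> in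
    its fibre, so a single term survives.\<close>
  have "pairing ?h f = (\<Sum>v\<in>Poly_Mapping.keys f. if v = u then Poly_Mapping.lookup f v else 0)"
    unfolding pairing_def using neg that exps by (intro sum.cong) auto
  then have "pairing ?h f = Poly_Mapping.lookup f u" using assms(2) by simp
  moreover have "pairing ?h f = 0" by (rule toric_ideal_pairing(2)[OF assms(1)]) simp
  ultimately show False using assms(2) by (simp add: in_keys_iff)
qed

section \<open>Initial ideals of generic costs\<close>

lemma keys_initial_form:
  "Poly_Mapping.keys (initial_form V c f)
    \<subseteq> {u \<in> Poly_Mapping.keys f. \<forall>v\<in>Poly_Mapping.keys f. cost V c v \<le> cost V c u}"
  unfolding initial_form_def by (rule order.trans[OF keys_sum]) (auto split: if_splits)

lemma generic_cost_unique:
  assumes "generic_cost R V A c" "optimal R V A c b u" "optimal R V A c b v"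
  shows "u = v"
proof -
  have "b \<in> matrix_apply R V A ` exponents V" using assms(2) by (auto simp: optimal_def)
  then show ?thesis using assms by (auto simp: generic_cost_def)
qed

text \<open>A cheaper replacement of \<open>u\<close> in its fibre would also make
  \<open>u + w\<close> cheaper. Hence non-optimality is inherited by multiples, as membership in a
  monomial ideal is.\<close>

lemma optimal_summand:
  assumes gen: "generic_cost R V A c"
    and opt: "optimal R V A c (matrix_apply R V A (u + w)) (u + w)"
  shows "optimal R V A c (matrix_apply R V A u) u"
proof -
  have uw: "u \<in> exponents V" "w \<in> exponents V"
    using opt by (simp_all add: optimal_def exponents_add)
  have "cost V c u \<le> cost V c v" if v: "v \<in> exponents V" "matrix_apply R V A v = matrix_apply R V A u"
    for v
  proof -
    have "matrix_apply R V A (v + w) = matrix_apply R V A (u + w)"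
      using v by (intro matrix_apply_add_cong) auto
    then have "cost V c (u + w) \<le> cost V c (v + w)"
      using opt v uw by (auto simp: optimal_def exponents_add)
    then show ?thesis by (simp add: cost_add)
  qed
  then show ?thesis using uw by (auto simp: optimal_def)
qed

text \<open>Doubling the optimal solution of the fibre of \<open>0\<close> stays in the fibre and does not
  increase the cost.\<close>

lemma generic_cost_optimal_0:
  assumes gen: "generic_cost R V A c"
  shows "optimal R V A c (matrix_apply R V A 0) 0"
proof -
  have "matrix_apply R V A 0 \<in> matrix_apply R V A ` exponents V" by simp
  then obtain u where u: "optimal R V A c (matrix_apply R V A 0) u"
    using gen unfolding generic_cost_def by metis
  then have "matrix_apply R V A (u + u) = matrix_apply R V A (0 + 0)"
    by (intro matrix_apply_add_cong) (simp_all add: optimal_def)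
  moreover have "cost V c u \<le> cost V c 0"
    using u exponents_0 unfolding optimal_def by blast
  ultimately have "optimal R V A c (matrix_apply R V A 0) (u + u)"
    using u by (auto simp: optimal_def exponents_add cost_add intro: add_decreasing)
  from generic_cost_unique[OF gen u this] have "u = 0" by simp
  then show ?thesis using u by simp
qed

text \<open>Polynomials with only non-optimal exponents form an ideal that contains every initial
  form, which gives one direction. For the other, a non-optimal \<open>u\<close> is the leading
  exponent of the binomial formed with the optimum of its fibre.\<close>

lemma monomial_mem_initial_ideal_iff:
  fixes I :: "('v, 'k::comm_ring_1) mpoly set"
  assumes gen: "generic_cost R V A c" and I: "I = toric_ideal R V A" and u: "u \<in> exponents V"
  shows "monomial u \<in> initial_ideal V c I \<longleftrightarrow> \<not> optimal R V A c (matrix_apply R V A u) u"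
proof
  \<comment> \<open>Both directions use \<open>K\<close>: it bounds the initial ideal from above,
    and it places the initial forms inside the ring, so that they belong to the ideal they
    generate.\<close>
  define N where "N = {u. \<not> optimal R V A c (matrix_apply R V A u) u}"
  define K :: "('v, 'k) mpoly set"
    where "K = {f \<in> carrier (poly_ring V). Poly_Mapping.keys f \<subseteq> N}"
  have "ideal K (poly_ring V)"
  proof (rule poly_ring_idealI)
    fix p q :: "('v, 'k) mpoly" assume p: "p \<in> K" and q: "q \<in> carrier (poly_ring V)"
    have "Poly_Mapping.keys (q * p) \<subseteq> N"
    proof
      fix w assume "w \<in> Poly_Mapping.keys (q * p)"
      then obtain a b where "w = a + b" "b \<in> Poly_Mapping.keys p"
        using keys_mult[of q p] by blast
      then show "w \<in> N"
        using p optimal_summand[OF gen, of b a] by (auto simp: K_def N_def add.commute)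
    qed
    then show "q * p \<in> K" using p q by (simp add: K_def poly_ring_mult_closed)
  next
    fix p q :: "('v, 'k) mpoly" assume "p \<in> K" "q \<in> K"
    then show "p + q \<in> K" using keys_add[of p q] by (auto simp: K_def poly_ring_def)
  qed (auto simp: K_def poly_ring_def)
  moreover have "initial_form V c ` I \<subseteq> K"
  proof safe
    fix f assume f: "f \<in> I"
    have "w \<in> N" if w: "w \<in> Poly_Mapping.keys (initial_form V c f)" for w
    proof -
      have w: "w \<in> Poly_Mapping.keys f" "\<And>v. v \<in> Poly_Mapping.keys f \<Longrightarrow> cost V c v \<le> cost V c w"
        using w keys_initial_form[of V c f] by auto
      obtain v where v: "v \<in> Poly_Mapping.keys f" "v \<noteq> w" "v \<in> exponents V"
        "matrix_apply R V A v = matrix_apply R V A w"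
        using toric_ideal_other_key[OF _ w(1)] f I by metis
      have False if "optimal R V A c (matrix_apply R V A w) w"
      proof -
        \<comment> \<open>A key of maximal cost costs at least as much as its companion
          \<open>v\<close>, so if \<open>w\<close> were optimal the fibre would have two
          optima.\<close>
        from that have "optimal R V A c (matrix_apply R V A w) v"
          using w(2)[OF v(1)] v by (force simp: optimal_def)
        then show False using generic_cost_unique[OF gen that] v(2) by blast
      qed
      then show ?thesis by (auto simp: N_def)
    qed
    then show "initial_form V c f \<in> K"
      using toric_ideal_pairing(1)[of f R V A] f I keys_initial_form[of V c f]
      by (auto simp: K_def poly_ring_def)
  qed
  ultimately have sub: "initial_ideal V c I \<subseteq> K"
    unfolding initial_ideal_def by (rule ring.genideal_minimal[OF poly_ring_ring])
  {
    assume "monomial u \<in> initial_ideal V c I"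
    then show "\<not> optimal R V A c (matrix_apply R V A u) u"
      using sub by (auto simp: K_def N_def)
  }
  assume nopt: "\<not> optimal R V A c (matrix_apply R V A u) u"
  obtain v where v: "optimal R V A c (matrix_apply R V A u) v"
    using gen u unfolding generic_cost_def by blast
  then have v': "v \<in> exponents V" "matrix_apply R V A u = matrix_apply R V A v" "u \<noteq> v"
    using nopt by (auto simp: optimal_def)
  \<comment> \<open>Strictness makes \<open>u\<close> the only term of maximal cost in the
    binomial.\<close>
  have less: "cost V c v < cost V c u"
    using nopt v u by (force simp: optimal_def)
  let ?S = "{monomial u - monomial v :: ('v, 'k) mpoly | u v.
      u \<in> exponents V \<and> v \<in> exponents V \<and> matrix_apply R V A u = matrix_apply R V A v}"
  let ?f = "monomial u - monomial v :: ('v, 'k) mpoly"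
  have "?S \<subseteq> carrier (poly_ring V)"
  proof safe
    fix u v assume "u \<in> exponents V" "v \<in> exponents V"
    then show "monomial u - monomial v \<in> carrier (poly_ring V :: ('v, 'k) mpoly ring)"
      using keys_diff[of "monomial u :: ('v, 'k) mpoly" "monomial v"] by (auto simp: poly_ring_def)
  qed
  from ring.genideal_self[OF poly_ring_ring this] have "?f \<in> I"
    unfolding I toric_ideal_def using u v' by blast
  moreover have "initial_form V c ?f = monomial u"
  proof -
    have keys: "Poly_Mapping.keys ?f = {u, v}"
      using v' by (auto simp: in_keys_iff lookup_minus lookup_single when_def split: if_splits)
    have "{x \<in> Poly_Mapping.keys ?f. \<forall>y\<in>Poly_Mapping.keys ?f. cost V c y \<le> cost V c x} = {u}"
      unfolding keys using less by auto
    then show ?thesis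
      unfolding initial_form_def using v'(3) by (simp add: lookup_minus lookup_single)
  qed
  moreover have "initial_form V c ` I \<subseteq> carrier (poly_ring V)"
    using \<open>initial_form V c ` I \<subseteq> K\<close> by (auto simp: K_def)
  from ring.genideal_self[OF poly_ring_ring this]
  have "initial_form V c ` I \<subseteq> initial_ideal V c I" by (simp add: initial_ideal_def)
  ultimately show "monomial u \<in> initial_ideal V c I" by (metis image_subset_iff)
qed

section \<open>Standard pairs and arithmetic degree\<close>

lemma admissible_pair_initial_ideal_iff:
  fixes I :: "('v, 'k::comm_ring_1) mpoly set"
  assumes "generic_cost R V A c" "I = toric_ideal R V A"
  shows "admissible_pair V (initial_ideal V c I) (a, \<sigma>) \<longleftrightarrow>
    a \<in> exponents V \<and> \<sigma> \<subseteq> V \<and> Poly_Mapping.keys a \<inter> \<sigma> = {} \<and>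
    (\<forall>w. Poly_Mapping.keys w \<subseteq> \<sigma> \<longrightarrow> optimal R V A c (matrix_apply R V A (a + w)) (a + w))"
proof -
  have "monomial a * monomial w \<notin> initial_ideal V c I \<longleftrightarrow>
      optimal R V A c (matrix_apply R V A (a + w)) (a + w)"
    if "a \<in> exponents V" "\<sigma> \<subseteq> V" "Poly_Mapping.keys w \<subseteq> \<sigma>" for w
  proof -
    have "a + w \<in> exponents V" using that by (auto simp: exponents_add) (auto simp: exponents_def)
    from monomial_mem_initial_ideal_iff[OF assms this] show ?thesis by (simp add: mult_single)
  qed
  then show ?thesis unfolding admissible_pair_def by auto
qed

text \<open>The exponent \<open>0\<close> has no summand other than \<open>0\<close>, so only pairs
  with the same monomial and a larger \<open>\<sigma>\<close> can compete.\<close>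

lemma standard_pairs_0I:
  fixes J :: "('v, 'k::comm_ring_1) mpoly set"
  assumes "admissible_pair V J (0, \<sigma>)"
    and max: "\<And>\<tau>. admissible_pair V J (0, \<tau>) \<Longrightarrow> \<sigma> \<subseteq> \<tau> \<Longrightarrow> \<tau> = \<sigma>"
  shows "(0, \<sigma>) \<in> standard_pairs V J"
proof -
  have "a = 0" if "0 = a + w" for a w :: "'v \<Rightarrow>\<^sub>0 nat"
  proof (rule poly_mapping_eqI)
    show "Poly_Mapping.lookup a x = Poly_Mapping.lookup 0 x" for x
      using arg_cong[OF that, of "\<lambda>m. Poly_Mapping.lookup m x"] by (simp add: lookup_add)
  qed
  then show ?thesis using assms(1) max unfolding standard_pairs_def by blast
qed

text \<open>The pair \<open>(0, {})\<close> is admissible because \<open>1\<close> is outside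
  \<open>J\<close>, and finiteness of \<open>V\<close> yields a maximal \<open>\<sigma>\<close>
  among the admissible pairs with exponent \<open>0\<close>.\<close>

lemma standard_pairs_nonempty:
  fixes J :: "('v, 'k::comm_ring_1) mpoly set"
  assumes "finite V" and "1 \<notin> J"
  shows "standard_pairs V J \<noteq> {}"
proof -
  let ?S = "{\<sigma>. admissible_pair V J (0, \<sigma>)}"
  have "?S \<subseteq> Pow V" by (auto simp: admissible_pair_def)
  then have fin: "finite ?S" using assms(1) by (meson finite_Pow_iff finite_subset)
  have "{} \<in> ?S" using assms(2) by (simp add: admissible_pair_def)
  then obtain \<sigma> where \<sigma>: "\<sigma> \<in> ?S" and max: "\<And>\<tau>. \<tau> \<in> ?S \<Longrightarrow> \<sigma> \<subseteq> \<tau> \<Longrightarrow> \<sigma> = \<tau>"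
    using finite_has_maximal[OF fin] by blast
  have "(0, \<sigma>) \<in> standard_pairs V J"
    using \<sigma> max by (intro standard_pairs_0I) auto
  then show ?thesis by blast
qed

text \<open>The exponent \<open>0\<close> is optimal in its fibre, so \<open>1\<close> is not in the
  initial ideal.\<close>

lemma arithmetic_degree_ge_1:
  fixes I :: "('v, 'k::comm_ring_1) mpoly set"
  assumes "finite V" "generic_cost R V A c" "I = toric_ideal R V A"
  shows "1 \<le> arithmetic_degree V (initial_ideal V c I)"
proof -
  have "1 \<notin> initial_ideal V c I"
    using monomial_mem_initial_ideal_iff[OF assms(2,3), of 0] generic_cost_optimal_0[OF assms(2)]
    by simp
  from standard_pairs_nonempty[OF assms(1) this] show ?thesis
    by (auto simp: arithmetic_degree_def one_enat_def Suc_le_eq card_gt_0_iff)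
qed

text \<open>The monomials outside the initial ideal are those in the variables of \<open>P\<close>.
  A pair is then admissible when it lives on \<open>P\<close>, and \<open>(0, P)\<close> dominates
  all such pairs.\<close>

lemma arithmetic_degree_eq_1:
  fixes I :: "('v, 'k::comm_ring_1) mpoly set"
  assumes gen: "generic_cost R V A c" and I: "I = toric_ideal R V A" and P: "P \<subseteq> V"
    and opt: "\<And>u. u \<in> exponents V \<Longrightarrow>
      optimal R V A c (matrix_apply R V A u) u \<longleftrightarrow> Poly_Mapping.keys u \<subseteq> P"
  shows "arithmetic_degree V (initial_ideal V c I) = 1"
proof -
  have adm: "admissible_pair V (initial_ideal V c I) (a, \<sigma>) \<longleftrightarrow>
    Poly_Mapping.keys a \<subseteq> P \<and> \<sigma> \<subseteq> P \<and> Poly_Mapping.keys a \<inter> \<sigma> = {}" for a \<sigma>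
  proof
    assume "admissible_pair V (initial_ideal V c I) (a, \<sigma>)"
    then have *: "a \<in> exponents V" "\<sigma> \<subseteq> V" "Poly_Mapping.keys a \<inter> \<sigma> = {}"
      "\<And>w. Poly_Mapping.keys w \<subseteq> \<sigma> \<Longrightarrow> optimal R V A c (matrix_apply R V A (a + w)) (a + w)"
      using admissible_pair_initial_ideal_iff[OF gen I] by blast+
    have "Poly_Mapping.keys (a + w) \<subseteq> P" if "Poly_Mapping.keys w \<subseteq> \<sigma>" for w
      using opt[of "a + w"] *(4)[OF that] by (simp add: optimal_def)
    \<comment> \<open>Taking \<open>w = 0\<close> puts the support of \<open>a\<close> into
      \<open>P\<close>; taking for \<open>w\<close> one variable of \<open>\<sigma>\<close> puts
      that variable into \<open>P\<close>.\<close>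
    from this[of 0] this[of "Poly_Mapping.single e 1" for e]
    show "Poly_Mapping.keys a \<subseteq> P \<and> \<sigma> \<subseteq> P \<and> Poly_Mapping.keys a \<inter> \<sigma> = {}"
      using *(3) by (auto simp: in_keys_iff lookup_add subset_iff)
  next
    assume *: "Poly_Mapping.keys a \<subseteq> P \<and> \<sigma> \<subseteq> P \<and> Poly_Mapping.keys a \<inter> \<sigma> = {}"
    have "optimal R V A c (matrix_apply R V A (a + w)) (a + w)" if "Poly_Mapping.keys w \<subseteq> \<sigma>" for w
    proof -
      have "Poly_Mapping.keys (a + w) \<subseteq> P" using * that keys_add[of a w] by blast
      with P opt[of "a + w"] show ?thesis by (simp add: exponents_def)
    qed
    then show "admissible_pair V (initial_ideal V c I) (a, \<sigma>)"
      using * P by (auto simp: admissible_pair_initial_ideal_iff[OF gen I] exponents_def)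
  qed
  have "standard_pairs V (initial_ideal V c I) = {(0, P)}"
  proof (intro equalityI subsetI)
    fix x assume x: "x \<in> standard_pairs V (initial_ideal V c I)"
    obtain a \<sigma> where [simp]: "x = (a, \<sigma>)" by (cases x)
    have "admissible_pair V (initial_ideal V c I) (a, \<sigma>)"
      and no: "\<And>a' \<sigma>' w. admissible_pair V (initial_ideal V c I) (a', \<sigma>') \<Longrightarrow> a = a' + w \<Longrightarrow>
        Poly_Mapping.keys w \<union> \<sigma> \<subseteq> \<sigma>' \<Longrightarrow> (a', \<sigma>') = (a, \<sigma>)"
      using x unfolding standard_pairs_def \<open>x = (a, \<sigma>)\<close> mem_Collect_eq prod.case by blast+
    then have "Poly_Mapping.keys a \<union> \<sigma> \<subseteq> P" by (simp add: adm)
    \<comment> \<open>The quotient of the monomial of \<open>a\<close> by \<open>1\<close> has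
      exponent \<open>a\<close>, hence the witness \<open>w = a\<close>.\<close>
    with no[of 0 P a] show "x \<in> {(0, P)}" by (simp add: adm)
  next
    have "(0, P) \<in> standard_pairs V (initial_ideal V c I)"
      by (rule standard_pairs_0I) (auto simp: adm)
    then show "x \<in> standard_pairs V (initial_ideal V c I)" if "x \<in> {(0, P)}" for x
      using that by simp
  qed
  then show ?thesis by (simp add: arithmetic_degree_def one_enat_def)
qed

section \<open>The Hamiltonian path of the tournament\<close>

definition path_arcs :: "nat \<Rightarrow> (nat \<times> nat) set"
  where "path_arcs d = (\<lambda>i. (i, Suc i)) ` {1..<d}"

definition path_cost :: "nat \<times> nat \<Rightarrow> real"
  where "path_cost = (\<lambda>(i, j). if j = Suc i then 0 else 1)"

lemma finite_arcs: "finite (arcs d)"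
  by (rule finite_subset[of _ "{1..d} \<times> {1..d}"]) (auto simp: arcs_def)

lemma path_arcs_subset: "path_arcs d \<subseteq> arcs d"
  by (auto simp: path_arcs_def arcs_def)

lemma cost_path_cost_nonneg: "0 \<le> cost V path_cost u"
  by (auto simp: cost_def path_cost_def intro!: sum_nonneg)

lemma cost_path_cost_eq_0_iff:
  assumes "u \<in> exponents (arcs d)"
  shows "cost (arcs d) path_cost u = 0 \<longleftrightarrow> Poly_Mapping.keys u \<subseteq> path_arcs d"
proof -
  have "cost (arcs d) path_cost u = 0 \<longleftrightarrow>
      (\<forall>e\<in>arcs d. path_cost e * real (Poly_Mapping.lookup u e) = 0)"
    unfolding cost_def by (rule sum_nonneg_eq_0_iff[OF finite_arcs]) (auto simp: path_cost_def)
  also have "\<dots> \<longleftrightarrow> Poly_Mapping.keys u \<subseteq> path_arcs d"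
  proof -
    have "path_cost e = 0 \<longleftrightarrow> e \<in> path_arcs d" if "e \<in> arcs d" for e
      using that by (cases e) (auto simp: path_cost_def path_arcs_def arcs_def)
    then show ?thesis
      using assms by (auto simp: exponents_def in_keys_iff subset_iff)
  qed
  finally show ?thesis .
qed

lemma matrix_apply_single:
  assumes "finite V" "e \<in> V"
  shows "matrix_apply R V A (Poly_Mapping.single e n) = (\<lambda>r\<in>R. A r e * int n)"
proof -
  have "(\<Sum>x\<in>V. A r x * int (Poly_Mapping.lookup (Poly_Mapping.single e n) x))
      = (\<Sum>x\<in>V. if x = e then A r x * int n else 0)" for r
    by (intro sum.cong) (auto simp: lookup_single when_def)
  then show ?thesis using assms by (simp add: matrix_apply_def)
qed

section \<open>Rerouting along the path\<close>

text \<open>The columns of \<open>(i, j)\<close> and \<open>(j, Suc j)\<close> add up to that of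
  \<open>(i, Suc j)\<close>, since the entries at vertex \<open>j\<close> cancel. The path from
  \<open>i\<close> to \<open>j\<close> thus grows one arc at a time.\<close>

lemma path_reroute_arc:
  assumes "1 \<le> i" "i < j" "j \<le> d"
  shows "\<exists>p. Poly_Mapping.keys p \<subseteq> path_arcs d \<and>
    matrix_apply {1..d} (arcs d) incidence p
      = matrix_apply {1..d} (arcs d) incidence (Poly_Mapping.single (i, j) 1)"
proof -
  from assms(2) have "Suc i \<le> j" by simp
  from this assms(3) show ?thesis
  proof (induction j rule: dec_induct)
    case base
    then show ?case
      using assms(1) by (intro exI[of _ "Poly_Mapping.single (i, Suc i) 1"]) (auto simp: path_arcs_def)
  next
    case (step j)
    then obtain p where p: "Poly_Mapping.keys p \<subseteq> path_arcs d"
      "matrix_apply {1..d} (arcs d) incidence p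
        = matrix_apply {1..d} (arcs d) incidence (Poly_Mapping.single (i, j) 1)"
      by auto
    let ?q = "Poly_Mapping.single (j, Suc j) (1::nat)"
    have arcs: "(i, j) \<in> arcs d" "(j, Suc j) \<in> arcs d" "(i, Suc j) \<in> arcs d"
      using step assms(1) by (auto simp: arcs_def)
    have "matrix_apply {1..d} (arcs d) incidence (p + ?q)
        = matrix_apply {1..d} (arcs d) incidence (Poly_Mapping.single (i, Suc j) 1)"
      using arcs step.hyps
      by (simp add: matrix_apply_add p(2) matrix_apply_single[OF finite_arcs] del: One_nat_def)
        (auto simp: restrict_def incidence_def fun_eq_iff)
    moreover have "Poly_Mapping.keys (p + ?q) \<subseteq> path_arcs d"
      using keys_add[of p ?q] p(1) step assms(1) by (auto simp: path_arcs_def)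
    ultimately show ?case by blast
  qed
qed

text \<open>Being reroutable is stable under sums, so it passes from single arcs to their multiples
  and then to the expansion of \<open>u\<close> into multiples of arcs.\<close>

lemma path_reroute:
  assumes "u \<in> exponents (arcs d)"
  shows "\<exists>p. Poly_Mapping.keys p \<subseteq> path_arcs d \<and>
    matrix_apply {1..d} (arcs d) incidence p = matrix_apply {1..d} (arcs d) incidence u"
proof -
  define P where "P u \<longleftrightarrow> (\<exists>p. Poly_Mapping.keys p \<subseteq> path_arcs d \<and>
    matrix_apply {1..d} (arcs d) incidence p = matrix_apply {1..d} (arcs d) incidence u)" for u
  have P0: "P 0" unfolding P_def by (intro exI[of _ 0]) auto
  have Padd: "P (u + v)" if "P u" "P v" for u v
  proof -
    from that obtain p q where "Poly_Mapping.keys p \<subseteq> path_arcs d" "Poly_Mapping.keys q \<subseteq> path_arcs d"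
      "matrix_apply {1..d} (arcs d) incidence p = matrix_apply {1..d} (arcs d) incidence u"
      "matrix_apply {1..d} (arcs d) incidence q = matrix_apply {1..d} (arcs d) incidence v"
      unfolding P_def by blast
    then show ?thesis
      unfolding P_def
      using keys_add[of p q] by (intro exI[of _ "p + q"] conjI matrix_apply_add_cong) blast+
  qed
  have Psingle: "P (Poly_Mapping.single e n)" if e: "e \<in> arcs d" for e n
  proof (induction n)
    case 0
    then show ?case using P0 by simp
  next
    case (Suc n)
    obtain i j where "e = (i, j)" "1 \<le> i" "i < j" "j \<le> d" using e by (cases e) (auto simp: arcs_def)
    then have "P (Poly_Mapping.single e 1)" using path_reroute_arc by (simp add: P_def)
    from Padd[OF this Suc.IH] show ?case by (simp flip: single_add)
  qed
  have "P (\<Sum>e\<in>S. Poly_Mapping.single e (Poly_Mapping.lookup u e))" if "finite S" "S \<subseteq> arcs d" for S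
    using that by (induction S rule: finite_induct) (simp_all add: P0 Padd Psingle)
  from this[of "Poly_Mapping.keys u"] show ?thesis
    using assms by (simp add: exponents_def P_def flip: poly_mapping_expand)
qed

section \<open>Uniqueness on the path\<close>

text \<open>Reading \<open>p\<close> as a flow, this is outflow minus inflow at \<open>v\<close>; at
  most one path arc leaves \<open>v\<close> and at most one enters it.\<close>

lemma matrix_apply_path:
  assumes "Poly_Mapping.keys p \<subseteq> path_arcs d" "v \<in> {1..d}"
  shows "matrix_apply {1..d} (arcs d) incidence p v
    = int (Poly_Mapping.lookup p (v, Suc v)) - int (Poly_Mapping.lookup p (v - 1, v))"
proof -
  let ?g = "\<lambda>i. int (Poly_Mapping.lookup p (i, Suc i))"
  \<comment> \<open>In particular \<open>(0, 1)\<close> and \<open>(d, Suc d)\<close> carry the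
    default value 0, so the end vertices \<open>1\<close> and \<open>d\<close> need no separate
    formula.\<close>
  have outside: "?g i = 0" if "i \<notin> {1..<d}" for i
    using assms(1) that by (force simp: path_arcs_def in_keys_iff)
  have "matrix_apply {1..d} (arcs d) incidence p v
      = (\<Sum>e\<in>path_arcs d. incidence v e * int (Poly_Mapping.lookup p e))"
  proof -
    have "Poly_Mapping.lookup p e = 0" if "e \<notin> path_arcs d" for e
      using assms(1) that by (auto simp: in_keys_iff)
    then show ?thesis
      using assms(2) path_arcs_subset[of d]
      by (auto simp: matrix_apply_def intro!: sum.mono_neutral_right finite_arcs)
  qed
  also have "\<dots> = (\<Sum>i\<in>{1..<d}. incidence v (i, Suc i) * ?g i)"
    unfolding path_arcs_def by (subst sum.reindex) (auto simp: inj_on_def)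
  \<comment> \<open>Since \<open>v\<close> is at least 1, \<open>v = Suc i\<close> is the same as
    \<open>v - 1 = i\<close> despite truncated subtraction.\<close>
  also have "\<dots> = (\<Sum>i\<in>{1..<d}. (if v = i then ?g i else 0) - (if v - 1 = i then ?g i else 0))"
    using assms(2) by (intro sum.cong) (auto simp: incidence_def)
  also have "\<dots> = ?g v - ?g (v - 1)"
    using outside[of v] outside[of "v - 1"] by (simp add: sum_subtractf sum.delta)
  finally show ?thesis using assms(2) by simp
qed

text \<open>The balance at a vertex and the flow entering it determine the flow leaving it, so the
  values are forced one after another along the path.\<close>

lemma path_unique:
  assumes "Poly_Mapping.keys p \<subseteq> path_arcs d" "Poly_Mapping.keys q \<subseteq> path_arcs d"
    and eq: "matrix_apply {1..d} (arcs d) incidence p = matrix_apply {1..d} (arcs d) incidence q"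
  shows "p = q"
proof -
  have step: "Poly_Mapping.lookup p (v, Suc v) = Poly_Mapping.lookup q (v, Suc v)" if "v \<le> d" for v
    using that
  proof (induction v)
    case 0
    \<comment> \<open>The induction starts at a fictitious arc into vertex \<open>1\<close>, where
      both flows vanish.\<close>
    have "(0, Suc 0) \<notin> path_arcs d" by (auto simp: path_arcs_def)
    then show ?case using assms(1,2) by (metis in_keys_iff subsetD)
  next
    case (Suc v)
    then show ?case
      using fun_cong[OF eq, of "Suc v"] matrix_apply_path[OF assms(1), of "Suc v"]
        matrix_apply_path[OF assms(2), of "Suc v"] by simp
  qed
  show ?thesis
  proof (rule poly_mapping_eqI)
    fix e
    show "Poly_Mapping.lookup p e = Poly_Mapping.lookup q e"
    proof (cases "e \<in> path_arcs d")
      case True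
      then show ?thesis using step by (auto simp: path_arcs_def)
    next
      case False
      then show ?thesis using assms(1,2) by (metis in_keys_iff subsetD)
    qed
  qed
qed

section \<open>Optimality and genericity for the path cost\<close>

text \<open>Costs are nonnegative and rerouting finds a point of cost 0 in every fibre, so optimal
  means cost 0, that is, supported on the path.\<close>

lemma optimal_path_cost_iff:
  "optimal {1..d} (arcs d) incidence path_cost b u \<longleftrightarrow>
    Poly_Mapping.keys u \<subseteq> path_arcs d \<and> matrix_apply {1..d} (arcs d) incidence u = b"
proof
  assume opt: "optimal {1..d} (arcs d) incidence path_cost b u"
  then have u: "u \<in> exponents (arcs d)" by (simp add: optimal_def)
  obtain p where p: "Poly_Mapping.keys p \<subseteq> path_arcs d"
    "matrix_apply {1..d} (arcs d) incidence p = matrix_apply {1..d} (arcs d) incidence u"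
    using path_reroute[OF u] by blast
  have p': "p \<in> exponents (arcs d)" using p path_arcs_subset by (auto simp: exponents_def)
  have "cost (arcs d) path_cost u \<le> cost (arcs d) path_cost p"
    using opt p p' by (auto simp: optimal_def)
  then have "cost (arcs d) path_cost u = 0"
    using cost_path_cost_eq_0_iff[OF p'] p cost_path_cost_nonneg[of "arcs d" u] by simp
  then show "Poly_Mapping.keys u \<subseteq> path_arcs d \<and> matrix_apply {1..d} (arcs d) incidence u = b"
    using cost_path_cost_eq_0_iff[OF u] opt by (simp add: optimal_def)
next
  assume u: "Poly_Mapping.keys u \<subseteq> path_arcs d \<and> matrix_apply {1..d} (arcs d) incidence u = b"
  then have "u \<in> exponents (arcs d)" using path_arcs_subset by (auto simp: exponents_def)
  then show "optimal {1..d} (arcs d) incidence path_cost b u"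
    using u cost_path_cost_eq_0_iff[of u d] by (simp add: optimal_def cost_path_cost_nonneg)
qed

text \<open>Rerouting gives existence of the optimum, and independence of the path columns gives its
  uniqueness.\<close>

lemma generic_cost_path_cost: "generic_cost {1..d} (arcs d) incidence path_cost"
  unfolding generic_cost_def optimal_path_cost_iff
proof
  fix b assume "b \<in> matrix_apply {1..d} (arcs d) incidence ` exponents (arcs d)"
  then obtain p where "Poly_Mapping.keys p \<subseteq> path_arcs d"
    "matrix_apply {1..d} (arcs d) incidence p = b"
    using path_reroute by blast
  then show "\<exists>!u. Poly_Mapping.keys u \<subseteq> path_arcs d \<and> matrix_apply {1..d} (arcs d) incidence u = b"
    using path_unique by blast
qed

theorem theorem4p14:
  fixes d :: nat
    and I :: "(nat \<times> nat, 'k::field) mpoly set"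
  assumes "d \<ge> 2"
    and "I = toric_ideal {1..d} (arcs d) incidence"
  shows "(\<exists>c. generic_cost {1..d} (arcs d) incidence c \<and>
            arithmetic_degree (arcs d) (initial_ideal (arcs d) c I) = 1) \<and>
         (\<forall>c. generic_cost {1..d} (arcs d) incidence c \<longrightarrow>
            1 \<le> arithmetic_degree (arcs d) (initial_ideal (arcs d) c I))"
proof (intro conjI allI impI)
  have "arithmetic_degree (arcs d) (initial_ideal (arcs d) path_cost I) = 1"
    by (rule arithmetic_degree_eq_1[OF generic_cost_path_cost assms(2) path_arcs_subset])
      (simp add: optimal_path_cost_iff del: One_nat_def)
  then show "\<exists>c. generic_cost {1..d} (arcs d) incidence c \<and>
      arithmetic_degree (arcs d) (initial_ideal (arcs d) c I) = 1"
    using generic_cost_path_cost by blast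
  show "1 \<le> arithmetic_degree (arcs d) (initial_ideal (arcs d) c I)"
    if "generic_cost {1..d} (arcs d) incidence c" for c
    using arithmetic_degree_ge_1[OF finite_arcs that assms(2)] .
qed

end
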